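(* There exist parameters $z_0,c\in\mathbb{C}$ with $\operatorname{Re}(z_0)\neq 0$, $\operatorname{Im}(z_0)\neq 0$, $\operatorname{Re}(c)\neq 0$, $\operatorname{Im}(c)\neq 0$, for which the Exponent Set $E(z_0,c)$ admits no finite universal escape radius. In particular, for $z_0=c=\frac{1+i}{10}$ the following holds: for every real $r>0$ there exists an exponent $x\in E(z_0,c)$ such that the orbit generated by $z_{n+1}=z_n^{\,x}+c$ from $z_0$ satisfies $|z_n|>r$ for some $n\ge 0$, while the orbit remains bounded.
   Context: Complex powers: for $z\in\mathbb{C}\setminus\{0\}$ let $\log z=\ln|z|+i\operatorname{Arg}(z)$ with $\operatorname{Arg}(z)\in(-\pi,\pi]$ (so $\operatorname{Arg}(-a)=\pi$ for $a>0$), and for $x\in\mathbb{C}$ set $z^x=\exp(x\log z)$. For $z=0$: $0^x=0$ if $\operatorname{Re}(x)>0$, and $0^x$ is undefined if $\operatorname{Re}(x)\le 0$. For $(z_0,c,x)\in\mathbb{C}^3$, the orbit $\{z_n\}$ is generated by $z_{n+1}=z_n^{\,x}+c$, continuing as long as the next iterate is defined and terminating otherwise. Exponent Set: for fixed $z_0,c\in\mathbb{C}$, $E(z_0,c)$ is the set of all $x\in\mathbb{C}$ such that $z_n$ is defined for every $n\ge 0$ and $\sup_{n\ge0}|z_n|<\infty$. Universal escape radius: for fixed $z_0,c\in\mathbb{C}$, a finite number $r>0$ is called a universal escape radius for $E(z_0,c)$ if, for every $x\in\mathbb{C}$ for which the orbit is well-defined for all $n\ge 0$, the existence of some $n\ge0$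 with $|z_n|>r$ implies $x\notin E(z_0,c)$. *)

theory Defs
  imports "HOL-Analysis.Analysis"
begin

text \<open>The library power has the branch cut wanted here (the imaginary part of
  \<open>Ln\<close> lies in \<open>{-pi<..pi}\<close>), but it totalises \<open>0 powr x = 0\<close>; \<open>None\<close> stands for
  an undefined power.\<close>

definition cpow :: "complex \<Rightarrow> complex \<Rightarrow> complex option" where
  "cpow z x = (if z = 0 then (if Re x > 0 then Some 0 else None) else Some (z powr x))"

text \<open>\<open>orbit z0 c x n = None\<close> means that the orbit has terminated before index \<open>n\<close>.\<close>

primrec orbit :: "complex \<Rightarrow> complex \<Rightarrow> complex \<Rightarrow> nat \<Rightarrow> complex option" where
  "orbit z0 c x 0 = Some z0"
| "orbit z0 c x (Suc n) =
     (case orbit z0 c x n of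
        None \<Rightarrow> None
      | Some z \<Rightarrow> (case cpow z x of None \<Rightarrow> None | Some w \<Rightarrow> Some (w + c)))"

definition is_full_orbit :: "complex \<Rightarrow> complex \<Rightarrow> complex \<Rightarrow> (nat \<Rightarrow> complex) \<Rightarrow> bool" where
  "is_full_orbit z0 c x z \<longleftrightarrow> (\<forall>n. orbit z0 c x n = Some (z n))"

definition exponent_set :: "complex \<Rightarrow> complex \<Rightarrow> complex set" where
  "exponent_set z0 c = {x. \<exists>z. is_full_orbit z0 c x z \<and> bdd_above (range (\<lambda>n. cmod (z n)))}"

definition universal_escape_radius :: "complex \<Rightarrow> complex \<Rightarrow> real \<Rightarrow> bool" where
  "universal_escape_radius z0 c r \<longleftrightarrow>
     r > 0 \<and>
     (\<forall>x z. is_full_orbit z0 c x z \<longrightarrow> (\<exists>n. cmod (z n) > r) \<longrightarrow> x \<notin> exponent_set z0 c)"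

end

theory Submission imports Defs begin

text \<open>The exponents are the negative integers \<open>x = - n\<close>, for which the iteration is the rational
  map \<open>z \<mapsto> 1 / z ^ n + c\<close>, and the start is \<open>z0 = c\<close> with \<open>0 < cmod c < 1\<close>. This map
  sends \<open>\<infinity>\<close> to \<open>c\<close> with multiplicity \<open>n\<close>. A small disc about \<open>c\<close> lies in the
  punctured unit disc, so for large \<open>n\<close> its image lies far out; there \<open>1 / z ^ n\<close> is tiny, so the
  second image falls back into the disc about \<open>c\<close>. The orbit of \<open>c\<close> therefore alternates forever
  between this disc and a bounded region far from the origin: it is bounded, but its point of
  index \<open>1\<close> has modulus about \<open>1 / cmod c ^ n\<close>, which exceeds any prescribed \<open>r\<close> once \<open>n\<close> is
  large (lemma \<open>large_bounded_orbit\<close>). An escape radius \<open>r\<close> is refuted by such an orbit.\<close>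

lemma cpow_minus_of_nat:
  assumes "z \<noteq> 0"
  shows "cpow z (- of_nat n) = Some (inverse (z ^ n))"
  using assms by (simp add: cpow_def powr_minus powr_nat')

lemma is_full_orbit_funpow:
  assumes step: "\<And>k. cpow ((f ^^ k) z0) x = Some (f ((f ^^ k) z0) - c)"
  shows "is_full_orbit z0 c x (\<lambda>k. (f ^^ k) z0)"
proof -
  have "orbit z0 c x k = Some ((f ^^ k) z0)" for k
    by (induction k) (simp_all add: step)
  then show ?thesis by (simp add: is_full_orbit_def)
qed

text \<open>The factor \<open>1 / 2\<close> in the radius \<open>d\<close> below keeps the disc about \<open>c\<close> at distance at least \<open>d\<close>
  both from \<open>0\<close>, which bounds the far images from above, and from the unit circle, which makes
  them uniformly large.\<close>

lemma large_bounded_orbit: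
  fixes c :: complex
  assumes c: "c \<noteq> 0" "cmod c < 1"
  shows "\<exists>x z. is_full_orbit c c x z \<and> (\<exists>n. cmod (z n) > r) \<and> bdd_above (range (\<lambda>n. cmod (z n)))"
proof -
  define d where "d = min (cmod c) (1 - cmod c) / 2"
  have d: "0 < d" "2 * d \<le> cmod c" "2 * d \<le> 1 - cmod c"
    using c by (auto simp: d_def)
  \<comment> \<open>On the disc of radius \<open>d\<close> about \<open>c\<close>, \<open>\<bar>r\<bar> + 3\<close> makes the image exceed \<open>r\<close> and \<open>2\<close> in modulus,
    the added \<open>c\<close> costing less than \<open>1\<close>; since \<open>1 / (1 - d) \<le> 2\<close>, the term \<open>1 / d\<close> ensures
    that the \<open>n\<close>th power of a number of modulus at least \<open>2\<close> has inverse of modulus at most \<open>d\<close>.\<close>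
  obtain n where n: "\<bar>r\<bar> + 3 + 1 / d < (1 / (1 - d)) ^ n"
  proof -
    have "1 < 1 / (1 - d)" using d c by (simp add: field_simps)
    then show ?thesis using real_arch_pow that by blast
  qed
  define f where "f = (\<lambda>z. inverse (z ^ n) + c)"
  have inv_n: "1 / d \<le> 2 ^ n"
  proof -
    have "(1 / (1 - d)) ^ n \<le> 2 ^ n"
      using d by (intro power_mono) (auto simp: field_simps)
    then show ?thesis using n by linarith
  qed
  have near: "d \<le> cmod z" "cmod z \<le> 1 - d" if "cmod (z - c) \<le> d" for z
    using that d norm_triangle_ineq2[of c z] norm_triangle_ineq2[of z c]
    by (auto simp: norm_minus_commute)
  have far: "2 \<le> cmod (f z)" "r < cmod (f z)" "cmod (f z) \<le> (1 / d) ^ n + 1"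
    if z: "cmod (z - c) \<le> d" for z
  proof -
    note z' = near[OF z]
    have "(1 / (1 - d)) ^ n \<le> (1 / cmod z) ^ n"
      using z' d by (intro power_mono frac_le) auto
    moreover have "(1 / cmod z) ^ n \<le> (1 / d) ^ n"
      using z' d by (intro power_mono frac_le) auto
    moreover have "cmod (inverse (z ^ n)) = (1 / cmod z) ^ n"
      by (simp add: norm_inverse norm_divide norm_power power_one_over inverse_eq_divide)
    moreover have "cmod (inverse (z ^ n)) - cmod c \<le> cmod (f z)"
      unfolding f_def by (rule norm_diff_ineq)
    moreover have "cmod (f z) \<le> cmod (inverse (z ^ n)) + cmod c"
      unfolding f_def by (rule norm_triangle_ineq)
    moreover have "0 < 1 / d" using d by simp
    ultimately show "2 \<le> cmod (f z)" "r < cmod (f z)" "cmod (f z) \<le> (1 / d) ^ n + 1"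
      using n c by linarith+
  qed
  have return: "cmod (f (f z) - c) \<le> d" if z: "cmod (z - c) \<le> d" for z
  proof -
    have "1 / d \<le> cmod (f z) ^ n"
      using inv_n power_mono[OF far(1)[OF z], of n] by linarith
    then have "inverse (cmod (f z) ^ n) \<le> inverse (1 / d)"
      using d by (intro le_imp_inverse_le) auto
    then show ?thesis by (simp add: f_def norm_inverse norm_power)
  qed
  have alternate: "cmod ((f ^^ k) c - c) \<le> d \<or> (\<exists>y. cmod (y - c) \<le> d \<and> (f ^^ k) c = f y)" for k
  proof (induction k)
    case 0
    then show ?case using d by simp
  next
    case (Suc k)
    then show ?case
    proof
      assume "cmod ((f ^^ k) c - c) \<le> d"
      then show ?thesis by (intro disjI2 exI[of _ "(f ^^ k) c"]) simp
    next
      assume "\<exists>y. cmod (y - c) \<le> d \<and> (f ^^ k) c = f y"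
      then obtain y where y: "cmod (y - c) \<le> d" "(f ^^ k) c = f y" by blast
      from return[OF y(1)] y(2) show ?thesis by simp
    qed
  qed
  have nz: "(f ^^ k) c \<noteq> 0" for k
    using alternate[of k]
  proof
    assume "cmod ((f ^^ k) c - c) \<le> d"
    from near(1)[OF this] d show ?thesis by auto
  next
    assume "\<exists>y. cmod (y - c) \<le> d \<and> (f ^^ k) c = f y"
    then obtain y where y: "cmod (y - c) \<le> d" "(f ^^ k) c = f y" by blast
    from far(1)[OF y(1)] y(2) show ?thesis by auto
  qed
  have "is_full_orbit c c (- of_nat n) (\<lambda>k. (f ^^ k) c)"
    by (rule is_full_orbit_funpow) (simp add: cpow_minus_of_nat[OF nz], simp add: f_def)
  moreover have "cmod ((f ^^ 1) c) > r"
    using far(2)[of c] d by simp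
  moreover have "cmod ((f ^^ k) c) \<le> (1 / d) ^ n + 1" for k
    using alternate[of k]
  proof
    assume "cmod ((f ^^ k) c - c) \<le> d"
    from near(2)[OF this] have "cmod ((f ^^ k) c) \<le> 1" using d by linarith
    also have "1 \<le> (1 / d) ^ n + 1" using d by simp
    finally show ?thesis .
  next
    assume "\<exists>y. cmod (y - c) \<le> d \<and> (f ^^ k) c = f y"
    then obtain y where y: "cmod (y - c) \<le> d" "(f ^^ k) c = f y" by blast
    from far(3)[OF y(1)] y(2) show ?thesis by simp
  qed
  then have "bdd_above (range (\<lambda>k. cmod ((f ^^ k) c)))"
    by (rule bdd_aboveI2)
  ultimately show ?thesis by blast
qed

theorem theorem3p5:
  "(\<exists>z0 c :: complex. Re z0 \<noteq> 0 \<and> Im z0 \<noteq> 0 \<and> Re c \<noteq> 0 \<and> Im c \<noteq> 0 \<and>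
      \<not> (\<exists>r. universal_escape_radius z0 c r)) \<and>
   (\<forall>z0 c :: complex. z0 = (1 + \<i>) / 10 \<and> c = (1 + \<i>) / 10 \<longrightarrow>
      (\<forall>r::real. r > 0 \<longrightarrow>
        (\<exists>x \<in> exponent_set z0 c. \<exists>z. is_full_orbit z0 c x z \<and>
           (\<exists>n. cmod (z n) > r) \<and> bdd_above (range (\<lambda>n. cmod (z n))))))"
proof -
  define c :: complex where "c = (1 + \<i>) / 10"
  have c: "Re c \<noteq> 0" "Im c \<noteq> 0" by (simp_all add: c_def)
  have "cmod c < 1"
    using cmod_le[of c] by (simp add: c_def)
  moreover have "c \<noteq> 0" using c by auto
  ultimately have orbits: "\<exists>x \<in> exponent_set c c. \<exists>z. is_full_orbit c c x z \<and>
      (\<exists>n. cmod (z n) > r) \<and> bdd_above (range (\<lambda>n. cmod (z n)))" for r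
    using large_bounded_orbit[of c r] by (fastforce simp: exponent_set_def)
  then have "\<not> (\<exists>r. universal_escape_radius c c r)"
    unfolding universal_escape_radius_def by blast
  show ?thesis
  proof (intro conjI allI impI)
    show "\<exists>z0 c. Re z0 \<noteq> 0 \<and> Im z0 \<noteq> 0 \<and> Re c \<noteq> 0 \<and> Im c \<noteq> 0 \<and>
        \<not> (\<exists>r. universal_escape_radius z0 c r)"
      using c \<open>\<not> (\<exists>r. universal_escape_radius c c r)\<close> by blast
  next
    fix z0 c' :: complex and r :: real
    assume "z0 = (1 + \<i>) / 10 \<and> c' = (1 + \<i>) / 10"
    then have "z0 = c" "c' = c" by (simp_all add: c_def)
    then show "\<exists>x \<in> exponent_set z0 c'. \<exists>z. is_full_orbit z0 c' x z \<and>
        (\<exists>n. cmod (z n) > r) \<and> bdd_above (range (\<lambda>n. cmod (z n)))"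
      using orbits[of r] by simp
  qed
qed

end
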